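(* Let $H$ be a co-Frobenius Hopf algebra over a field $k$ with antipode $S$, and let $\alpha \in H^*$ and $g \in H$ be the distinguished grouplike elements of $H^*$ and $H$, respectively. Then for all $h\in H$, $$S^4(h)=g\,(\alpha \rightharpoonup h\leftharpoonup \alpha^{-1})\,g^{-1}.$$
   Context: $H$ is not assumed finite dimensional. Sweedler notation $\Delta(h)=h_1\otimes h_2$ (summation understood) is used; $H^*$ is the linear dual with the convolution product. Integrals: $\lambda\in H^*$ is a left integral for $H$ in $H^*$, $\lambda\in\int_l^{H^*}$, if $h_1\lambda(h_2)=\lambda(h)1$ for all $h\in H$; $\Lambda\in H^*$ is a right integral, $\Lambda\in\int_r^{H^*}$, if $\Lambda(h_1)h_2=\Lambda(h)1$ for all $h\in H$. $H$ is co-Frobenius if $\int_l^{H^*}\neq 0$ (equivalently $\int_r^{H^*}\neq 0$). In this case both spaces are one dimensional and the antipode $S$ is bijective. Actions: for $h^*\in H^*$ and $h,h'\in H$, $h^*\rightharpoonup h=h^*(h_2)h_1$, $h\leftharpoonup h^*=h^*(h_1)h_2$, $\langle h\rightharpoonup h^*,h'\rangle=\langle h^*,h'h\rangle$, $\langle h^*\leftharpoonup h,h'\rangle=\langle h^*,hh'\rangle$. For $0\neq\lambda\in\int_l^{H^*}$ the maps $h\mapsto h\rightharpoonup\lambda$ and $h\mapsto\lambda\leftharpoonup h$ are bijections from $H$ onto $H^{*\mathrm{rat}}$, the unique maximal rational submodule of $H^*$. Distinguished grouplike in $H$: the grouplike element $g\in H$ such that $\lambda(h_1)h_2=\lambda(h)g^{-1}$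 and $h_1\Lambda(h_2)=\Lambda(h)g$ for all $\lambda\in\int_l^{H^*}$, $\Lambda\in\int_r^{H^*}$, $h\in H$. Distinguished grouplike in $H^*$: fix $0\neq\lambda\in\int_l^{H^*}$ and let $\chi:H\to H$ be the algebra isomorphism (the generalized Nakayama automorphism, independent of the choice of $\lambda$) defined by $h\rightharpoonup\lambda=\lambda\leftharpoonup\chi(h)$, i.e. $\lambda(xy)=\lambda(\chi(y)x)$ for all $x,y\in H$. Then $\alpha:=\varepsilon\circ\chi\in H^*$, an algebra map $H\to k$ that is invertible for convolution, with inverse $\alpha^{-1}=\alpha\circ S$. *)

theory Defs
  imports Complex_Main "HOL-Library.Poly_Mapping"
begin

section \<open>Free vector spaces and tensor powers\<close>

text \<open>The finitely supported functions \<^typ>\<open>'x \<Rightarrow>\<^sub>0 'k\<close> form the free vector space on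
  \<^typ>\<open>'x\<close>, with basis vectors \<^term>\<open>Poly_Mapping.single x 1\<close>.\<close>

definition fscale :: "'k::field \<Rightarrow> ('x \<Rightarrow>\<^sub>0 'k) \<Rightarrow> ('x \<Rightarrow>\<^sub>0 'k)" where
  "fscale c p = Poly_Mapping.map (\<lambda>x. c * x) p"

lemma lookup_fscale [simp]: "Poly_Mapping.lookup (fscale c p) x = c * Poly_Mapping.lookup p x"
  by (simp add: fscale_def map.rep_eq when_def)

lemma vector_space_fscale: "vector_space (fscale :: 'k::field \<Rightarrow> ('x \<Rightarrow>\<^sub>0 'k) \<Rightarrow> _)"
  by unfold_locales (auto intro!: poly_mapping_eqI simp: lookup_add algebra_simps)

definition basis_vec :: "'x \<Rightarrow> ('x \<Rightarrow>\<^sub>0 'k::field)" where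
  "basis_vec x = Poly_Mapping.single x 1"

definition lin_ext :: "('k::field \<Rightarrow> 'w \<Rightarrow> 'w) \<Rightarrow> ('x \<Rightarrow> 'w) \<Rightarrow> ('x \<Rightarrow>\<^sub>0 'k) \<Rightarrow> 'w::comm_monoid_add" where
  "lin_ext s f p = (\<Sum>x\<in>Poly_Mapping.keys p. s (Poly_Mapping.lookup p x) (f x))"

text \<open>\<open>V \<otimes> V\<close> and \<open>V \<otimes> V \<otimes> V\<close> are the quotients of the free vector spaces on
  \<open>V \<times> V\<close> and \<open>V \<times> V \<times> V\<close> by the subspaces expressing multilinearity; their
  elements are the cosets.  Here \<^term>\<open>scale\<close> is the scalar multiplication of \<open>V\<close>.\<close>

definition bilinear_rels :: "('k::field \<Rightarrow> 'v \<Rightarrow> 'v) \<Rightarrow> ('v::ab_group_add \<times> 'v \<Rightarrow>\<^sub>0 'k) set" where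
  "bilinear_rels scale =
     {basis_vec (a + a', b) - basis_vec (a, b) - basis_vec (a', b) | a a' b. True} \<union>
     {basis_vec (a, b + b') - basis_vec (a, b) - basis_vec (a, b') | a b b'. True} \<union>
     {basis_vec (scale c a, b) - fscale c (basis_vec (a, b)) | c a b. True} \<union>
     {basis_vec (a, scale c b) - fscale c (basis_vec (a, b)) | c a b. True}"

definition trilinear_rels ::
    "('k::field \<Rightarrow> 'v \<Rightarrow> 'v) \<Rightarrow> ('v::ab_group_add \<times> 'v \<times> 'v \<Rightarrow>\<^sub>0 'k) set" where
  "trilinear_rels scale =
     {basis_vec (a + a', b, d) - basis_vec (a, b, d) - basis_vec (a', b, d) | a a' b d. True} \<union>
     {basis_vec (a, b + b', d) - basis_vec (a, b, d) - basis_vec (a, b', d) | a b b' d. True} \<union>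
     {basis_vec (a, b, d + d') - basis_vec (a, b, d) - basis_vec (a, b, d') | a b d d'. True} \<union>
     {basis_vec (scale c a, b, d) - fscale c (basis_vec (a, b, d)) | c a b d. True} \<union>
     {basis_vec (a, scale c b, d) - fscale c (basis_vec (a, b, d)) | c a b d. True} \<union>
     {basis_vec (a, b, scale c d) - fscale c (basis_vec (a, b, d)) | c a b d. True}"

definition tensor2 ::
    "('k::field \<Rightarrow> 'v \<Rightarrow> 'v) \<Rightarrow> ('v::ab_group_add \<times> 'v \<Rightarrow>\<^sub>0 'k) \<Rightarrow> ('v \<times> 'v \<Rightarrow>\<^sub>0 'k) set" where
  "tensor2 scale p = {q. q - p \<in> module.span fscale (bilinear_rels scale)}"

definition tensor3 ::
    "('k::field \<Rightarrow> 'v \<Rightarrow> 'v) \<Rightarrow> ('v::ab_group_add \<times> 'v \<times> 'v \<Rightarrow>\<^sub>0 'k) \<Rightarrow>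
     ('v \<times> 'v \<times> 'v \<Rightarrow>\<^sub>0 'k) set" where
  "tensor3 scale p = {q. q - p \<in> module.span fscale (trilinear_rels scale)}"

definition rep :: "'x set \<Rightarrow> 'x" where
  "rep X = (SOME p. p \<in> X)"


section \<open>Hopf algebras\<close>

text \<open>\<^term>\<open>sweedler s \<Delta> f h\<close> is the sum \<open>f h\<^sub>1 h\<^sub>2\<close> in Sweedler notation, with values
  in a vector space with scalar multiplication \<^term>\<open>s\<close>; for bilinear \<^term>\<open>f\<close> it does not
  depend on the chosen representative of \<^term>\<open>\<Delta> h\<close>.  Below, \<^term>\<open>f\<close> is sometimes a map into a
  free vector space which is multilinear only modulo the tensor relations; then the coset of the
  sum is independent of the representative.\<close>

definition sweedler ::
    "('k::field \<Rightarrow> 'w \<Rightarrow> 'w) \<Rightarrow> ('h \<Rightarrow> ('h \<times> 'h \<Rightarrow>\<^sub>0 'k) set) \<Rightarrow> ('h \<Rightarrow> 'h \<Rightarrow> 'w) \<Rightarrow> 'h \<Rightarrow>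
     'w::comm_monoid_add" where
  "sweedler s \<Delta> f h = lin_ext s (\<lambda>(h1, h2). f h1 h2) (rep (\<Delta> h))"

locale k_algebra = vector_space scale
  for scale :: "'k::field \<Rightarrow> 'h::ring_1 \<Rightarrow> 'h" +
  assumes scale_mult_left: "scale c x * y = scale c (x * y)"
    and scale_mult_right: "x * scale c y = scale c (x * y)"

locale k_coalgebra = vector_space scale
  for scale :: "'k::field \<Rightarrow> 'h::ab_group_add \<Rightarrow> 'h" +
  fixes \<Delta> :: "'h \<Rightarrow> ('h \<times> 'h \<Rightarrow>\<^sub>0 'k) set"
    and \<epsilon> :: "'h \<Rightarrow> 'k"
  assumes comult_tensor: "\<Delta> h \<in> range (tensor2 scale)"
    and comult_add: "\<Delta> (x + y) = tensor2 scale (rep (\<Delta> x) + rep (\<Delta> y))"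
    and comult_scale: "\<Delta> (scale c x) = tensor2 scale (fscale c (rep (\<Delta> x)))"
    and counit_linear: "Vector_Spaces.linear scale (*) \<epsilon>"
    and coassoc:
      "tensor3 scale (sweedler fscale \<Delta>
         (\<lambda>h1 h2. sweedler fscale \<Delta> (\<lambda>h11 h12. basis_vec (h11, h12, h2)) h1) h) =
       tensor3 scale (sweedler fscale \<Delta>
         (\<lambda>h1 h2. sweedler fscale \<Delta> (\<lambda>h21 h22. basis_vec (h1, h21, h22)) h2) h)"
    and counit_left: "sweedler scale \<Delta> (\<lambda>h1 h2. scale (\<epsilon> h1) h2) h = h"
    and counit_right: "sweedler scale \<Delta> (\<lambda>h1 h2. scale (\<epsilon> h2) h1) h = h"

locale k_bialgebra = k_algebra scale + k_coalgebra scale \<Delta> \<epsilon>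
  for scale :: "'k::field \<Rightarrow> 'h::ring_1 \<Rightarrow> 'h" and \<Delta> \<epsilon> +
  assumes comult_one: "\<Delta> 1 = tensor2 scale (basis_vec (1, 1))"
    and comult_mult:
      "\<Delta> (x * y) = tensor2 scale (sweedler fscale \<Delta>
         (\<lambda>x1 x2. sweedler fscale \<Delta> (\<lambda>y1 y2. basis_vec (x1 * y1, x2 * y2)) y) x)"
    and counit_one: "\<epsilon> 1 = 1"
    and counit_mult: "\<epsilon> (x * y) = \<epsilon> x * \<epsilon> y"

locale hopf_algebra = k_bialgebra scale \<Delta> \<epsilon>
  for scale :: "'k::field \<Rightarrow> 'h::ring_1 \<Rightarrow> 'h" and \<Delta> \<epsilon> +
  fixes S :: "'h \<Rightarrow> 'h"
  assumes antipode_linear: "Vector_Spaces.linear scale scale S"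
    and antipode_left: "sweedler scale \<Delta> (\<lambda>h1 h2. S h1 * h2) h = scale (\<epsilon> h) 1"
    and antipode_right: "sweedler scale \<Delta> (\<lambda>h1 h2. h1 * S h2) h = scale (\<epsilon> h) 1"


section \<open>The dual algebra, actions and integrals\<close>

definition dual :: "('k::field \<Rightarrow> 'h \<Rightarrow> 'h) \<Rightarrow> ('h::ab_group_add \<Rightarrow> 'k) set" where
  "dual scale = {l. Vector_Spaces.linear scale (*) l}"

definition convolution ::
    "('h \<Rightarrow> ('h \<times> 'h \<Rightarrow>\<^sub>0 'k::field) set) \<Rightarrow> ('h \<Rightarrow> 'k) \<Rightarrow> ('h \<Rightarrow> 'k) \<Rightarrow> 'h \<Rightarrow> 'k" where
  "convolution \<Delta> l m h = sweedler (*) \<Delta> (\<lambda>h1 h2. l h1 * m h2) h"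

definition conv_inverse ::
    "('k::field \<Rightarrow> 'h \<Rightarrow> 'h) \<Rightarrow> ('h \<Rightarrow> ('h \<times> 'h \<Rightarrow>\<^sub>0 'k) set) \<Rightarrow> ('h \<Rightarrow> 'k) \<Rightarrow>
     ('h::ab_group_add \<Rightarrow> 'k) \<Rightarrow> ('h \<Rightarrow> 'k)" where
  "conv_inverse scale \<Delta> \<epsilon> l =
     (THE m. m \<in> dual scale \<and> convolution \<Delta> l m = \<epsilon> \<and> convolution \<Delta> m l = \<epsilon>)"

definition mult_inverse :: "'h::monoid_mult \<Rightarrow> 'h" where
  "mult_inverse x = (THE y. x * y = 1 \<and> y * x = 1)"

text \<open>The actions of \<open>H\<^sup>*\<close> on \<open>H\<close> and of \<open>H\<close> on \<open>H\<^sup>*\<close>: \<open>h\<^sup>* \<rightharpoonup> h\<close>, \<open>h \<leftharpoonup> h\<^sup>*\<close>,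
  \<open>h \<rightharpoonup> h\<^sup>*\<close>, \<open>h\<^sup>* \<leftharpoonup> h\<close>, in this order.\<close>

definition dual_act_left ::
    "('k::field \<Rightarrow> 'h \<Rightarrow> 'h) \<Rightarrow> ('h \<Rightarrow> ('h \<times> 'h \<Rightarrow>\<^sub>0 'k) set) \<Rightarrow> ('h \<Rightarrow> 'k) \<Rightarrow> 'h \<Rightarrow>
     'h::ab_group_add" where
  "dual_act_left scale \<Delta> l h = sweedler scale \<Delta> (\<lambda>h1 h2. scale (l h2) h1) h"

definition dual_act_right ::
    "('k::field \<Rightarrow> 'h \<Rightarrow> 'h) \<Rightarrow> ('h \<Rightarrow> ('h \<times> 'h \<Rightarrow>\<^sub>0 'k) set) \<Rightarrow> 'h \<Rightarrow> ('h \<Rightarrow> 'k) \<Rightarrow>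
     'h::ab_group_add" where
  "dual_act_right scale \<Delta> h l = sweedler scale \<Delta> (\<lambda>h1 h2. scale (l h1) h2) h"

definition act_left :: "'h::times \<Rightarrow> ('h \<Rightarrow> 'k) \<Rightarrow> ('h \<Rightarrow> 'k)" where
  "act_left h l = (\<lambda>h'. l (h' * h))"

definition act_right :: "('h \<Rightarrow> 'k) \<Rightarrow> 'h::times \<Rightarrow> ('h \<Rightarrow> 'k)" where
  "act_right l h = (\<lambda>h'. l (h * h'))"

definition left_integrals ::
    "('k::field \<Rightarrow> 'h \<Rightarrow> 'h) \<Rightarrow> ('h \<Rightarrow> ('h \<times> 'h \<Rightarrow>\<^sub>0 'k) set) \<Rightarrow> ('h::ring_1 \<Rightarrow> 'k) set" where
  "left_integrals scale \<Delta> =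
     {l \<in> dual scale. \<forall>h. sweedler scale \<Delta> (\<lambda>h1 h2. scale (l h2) h1) h = scale (l h) 1}"

definition right_integrals ::
    "('k::field \<Rightarrow> 'h \<Rightarrow> 'h) \<Rightarrow> ('h \<Rightarrow> ('h \<times> 'h \<Rightarrow>\<^sub>0 'k) set) \<Rightarrow> ('h::ring_1 \<Rightarrow> 'k) set" where
  "right_integrals scale \<Delta> =
     {r \<in> dual scale. \<forall>h. sweedler scale \<Delta> (\<lambda>h1 h2. scale (r h1) h2) h = scale (r h) 1}"

definition co_frobenius ::
    "('k::field \<Rightarrow> 'h \<Rightarrow> 'h) \<Rightarrow> ('h::ring_1 \<Rightarrow> ('h \<times> 'h \<Rightarrow>\<^sub>0 'k) set) \<Rightarrow> bool" where
  "co_frobenius scale \<Delta> \<longleftrightarrow> (\<exists>l \<in> left_integrals scale \<Delta>. l \<noteq> (\<lambda>_. 0))"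


section \<open>Distinguished grouplike elements\<close>

definition grouplike ::
    "('k::field \<Rightarrow> 'h \<Rightarrow> 'h) \<Rightarrow> ('h \<Rightarrow> ('h \<times> 'h \<Rightarrow>\<^sub>0 'k) set) \<Rightarrow> ('h \<Rightarrow> 'k) \<Rightarrow>
     'h::ab_group_add \<Rightarrow> bool" where
  "grouplike scale \<Delta> \<epsilon> g \<longleftrightarrow> \<Delta> g = tensor2 scale (basis_vec (g, g)) \<and> \<epsilon> g = 1"

definition distinguished_grouplike ::
    "('k::field \<Rightarrow> 'h \<Rightarrow> 'h) \<Rightarrow> ('h \<Rightarrow> ('h \<times> 'h \<Rightarrow>\<^sub>0 'k) set) \<Rightarrow> ('h \<Rightarrow> 'k) \<Rightarrow>
     'h::ring_1 \<Rightarrow> bool" where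
  "distinguished_grouplike scale \<Delta> \<epsilon> g \<longleftrightarrow>
     grouplike scale \<Delta> \<epsilon> g \<and>
     (\<forall>l \<in> left_integrals scale \<Delta>. \<forall>h.
        sweedler scale \<Delta> (\<lambda>h1 h2. scale (l h1) h2) h = scale (l h) (mult_inverse g)) \<and>
     (\<forall>r \<in> right_integrals scale \<Delta>. \<forall>h.
        sweedler scale \<Delta> (\<lambda>h1 h2. scale (r h2) h1) h = scale (r h) g)"

definition algebra_automorphism :: "('k::field \<Rightarrow> 'h \<Rightarrow> 'h) \<Rightarrow> ('h::ring_1 \<Rightarrow> 'h) \<Rightarrow> bool" where
  "algebra_automorphism scale \<chi> \<longleftrightarrow>
     Vector_Spaces.linear scale scale \<chi> \<and> \<chi> 1 = 1 \<and> (\<forall>x y. \<chi> (x * y) = \<chi> x * \<chi> y) \<and> bij \<chi>"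

definition nakayama_automorphism ::
    "('k::field \<Rightarrow> 'h \<Rightarrow> 'h) \<Rightarrow> ('h::ring_1 \<Rightarrow> 'k) \<Rightarrow> ('h \<Rightarrow> 'h) \<Rightarrow> bool" where
  "nakayama_automorphism scale l \<chi> \<longleftrightarrow>
     algebra_automorphism scale \<chi> \<and> (\<forall>h. act_left h l = act_right l (\<chi> h))"

definition distinguished_dual_grouplike ::
    "('k::field \<Rightarrow> 'h \<Rightarrow> 'h) \<Rightarrow> ('h \<Rightarrow> ('h \<times> 'h \<Rightarrow>\<^sub>0 'k) set) \<Rightarrow> ('h \<Rightarrow> 'k) \<Rightarrow>
     ('h::ring_1 \<Rightarrow> 'k) \<Rightarrow> bool" where
  "distinguished_dual_grouplike scale \<Delta> \<epsilon> \<alpha> \<longleftrightarrow>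
     (\<exists>l \<in> left_integrals scale \<Delta>. \<exists>\<chi>.
        l \<noteq> (\<lambda>_. 0) \<and> nakayama_automorphism scale l \<chi> \<and> \<alpha> = \<epsilon> \<circ> \<chi>)"

end

theory Submission
  imports Defs
begin

text \<open>Invariance of the left integral \<open>\<lambda>\<close> gives \<open>S(h\<^sub>1) \<lambda>(h\<^sub>2 m) = m\<^sub>1 \<lambda>(h m\<^sub>2)\<close> and
  \<open>\<lambda>(h\<^sub>1 m) h\<^sub>2 = \<lambda>(h m\<^sub>1) g\<^sup>-\<^sup>1 S(m\<^sub>2)\<close>.  Using each identity twice, with the Nakayama rule
  \<open>\<lambda>(x y) = \<lambda>(\<chi>(y) x)\<close> in between, turns them into identities in \<open>H \<otimes> H\<close> with one leg under
  \<open>\<lambda>(_ h)\<close>; nondegeneracy of \<open>\<lambda>\<close> removes the integral: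
  \<open>m\<^sub>1 \<otimes> \<chi>(m\<^sub>2) = S\<^sup>2(\<chi>(m)\<^sub>1) \<otimes> \<chi>(m)\<^sub>2\<close> and \<open>S\<^sup>2(m\<^sub>2) g \<otimes> \<chi>(m\<^sub>1) = g \<chi>(m)\<^sub>2 \<otimes> \<chi>(m)\<^sub>1\<close>.
  Applying \<open>\<epsilon>\<close> yields \<open>\<alpha> \<rightharpoonup> m = S\<^sup>2(\<chi>(m))\<close> and \<open>S\<^sup>2(m \<leftharpoonup> \<alpha>) g = g \<chi>(m)\<close>, hence
  \<open>S\<^sup>4(m \<leftharpoonup> \<alpha>) = g (\<alpha> \<rightharpoonup> m) g\<^sup>-\<^sup>1\<close>.\<close>

section \<open>Sweedler sums\<close>

lemma linearI':
  assumes "vector_space s" "vector_space t"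
    and "\<And>x y. f (x + y) = f x + f y" and "\<And>c x. f (s c x) = t c (f x)"
  shows "Vector_Spaces.linear s t f"
  using assms by (simp add: Vector_Spaces.linear_iff)

lemma linearD:
  assumes "Vector_Spaces.linear s t f"
  shows "vector_space s" "vector_space t"
    "f (x + y) = f x + f y" "f (x - y) = f x - f y" "f (s c x) = t c (f x)" "f 0 = 0"
proof -
  interpret module_hom s t f
    using assms by (simp add: Vector_Spaces.linear_iff_module_hom)
  show "vector_space s" "vector_space t" using assms by (simp_all add: Vector_Spaces.linear_iff)
  show "f (x + y) = f x + f y" "f (x - y) = f x - f y" "f (s c x) = t c (f x)" "f 0 = 0"
    by (simp_all add: add diff scale)
qed

lemma linear_comp:
  assumes "Vector_Spaces.linear s t f" "Vector_Spaces.linear r s (\<lambda>x. g x)"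
  shows "Vector_Spaces.linear r t (\<lambda>x. f (g x))"
  using assms by (simp add: Vector_Spaces.linear_iff)

section \<open>Linear extension from free vector spaces and descent to their quotients\<close>

lemma lin_ext_superset:
  assumes "vector_space s" "finite A" "Poly_Mapping.keys p \<subseteq> A"
  shows "lin_ext s f p = (\<Sum>x\<in>A. s (Poly_Mapping.lookup p x) (f x))"
proof -
  interpret vector_space s by fact
  show ?thesis
    unfolding lin_ext_def using assms(2,3)
    by (intro sum.mono_neutral_left) (auto simp: in_keys_iff)
qed

lemma linear_lin_ext:
  fixes f :: "'x \<Rightarrow> 'w::ab_group_add" and s :: "'k::field \<Rightarrow> 'w \<Rightarrow> 'w"
  assumes "vector_space s"
  shows "Vector_Spaces.linear fscale s (lin_ext s f)"
proof (rule linearI'[OF vector_space_fscale assms])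
  interpret vector_space s by fact
  fix p q :: "'x \<Rightarrow>\<^sub>0 'k" and c
  let ?A = "Poly_Mapping.keys p \<union> Poly_Mapping.keys q"
  have "Poly_Mapping.keys (p + q) \<subseteq> ?A" by (rule Poly_Mapping.keys_add)
  then show "lin_ext s f (p + q) = lin_ext s f p + lin_ext s f q"
    by (simp add: lin_ext_superset[OF assms, of ?A] lookup_add scale_left_distrib sum.distrib)
  have "Poly_Mapping.keys (fscale c p) \<subseteq> Poly_Mapping.keys p"
    by (auto simp: in_keys_iff)
  then show "lin_ext s f (fscale c p) = s c (lin_ext s f p)"
    by (simp add: lin_ext_superset[OF assms, of "Poly_Mapping.keys p"] scale_sum_right)
qed

lemma lin_ext_basis_vec:
  assumes "vector_space s"
  shows "lin_ext s f (basis_vec x) = f x"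
proof -
  interpret vector_space s by fact
  show ?thesis
    by (simp add: lin_ext_def basis_vec_def)
qed

lemma linear_lin_ext_apply:
  assumes "Vector_Spaces.linear s t T"
  shows "T (lin_ext s f p) = lin_ext t (\<lambda>x. T (f x)) p"
proof -
  interpret module_hom s t T
    using assms by (simp add: Vector_Spaces.linear_iff_module_hom)
  show ?thesis
    by (simp add: lin_ext_def sum scale)
qed

text \<open>Universal property of the quotient: the linear extension is linear, so killing the
  relations \<open>R\<close> makes it kill their span and agree on a whole coset.\<close>

lemma lin_ext_eqI:
  fixes f :: "'x \<Rightarrow> 'w::ab_group_add" and s :: "'k::field \<Rightarrow> 'w \<Rightarrow> 'w"
  assumes s: "vector_space s"
    and pq: "p - q \<in> module.span fscale R"
    and R: "\<And>r. r \<in> R \<Longrightarrow> lin_ext s f r = 0"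
  shows "lin_ext s f p = lin_ext s f q"
proof -
  interpret F: vector_space "fscale :: 'k \<Rightarrow> ('x \<Rightarrow>\<^sub>0 'k) \<Rightarrow> _" by (rule vector_space_fscale)
  interpret W: vector_space s by fact
  note L = linear_lin_ext[OF s, of f]
  have "lin_ext s f (p - q) = 0"
    using pq
  proof (induction rule: F.span_induct)
    case base
    show ?case by (auto simp: F.subspace_def linearD[OF L])
  next
    case (step r)
    then show ?case by (rule R)
  qed
  then show ?thesis by (simp add: linearD[OF L])
qed

text \<open>Holds for arbitrary \<open>f\<close>: once a representative is chosen, a Sweedler sum is
  just a finite linear combination.\<close>

lemma sweedler_linear:
  assumes "Vector_Spaces.linear s t T"
  shows "T (sweedler s \<Delta> f h) = sweedler t \<Delta> (\<lambda>a b. T (f a b)) h"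
  unfolding sweedler_def linear_lin_ext_apply[OF assms] by (simp add: case_prod_unfold)

lemma linear_sweedler:
  assumes "\<And>a b. Vector_Spaces.linear r s (\<lambda>x. f x a b)"
  shows "Vector_Spaces.linear r s (\<lambda>x. sweedler s \<Delta> (f x) h)"
proof -
  note D = linearD[OF assms]
  interpret vector_space s by (rule D(2))
  show ?thesis
    by (rule linearI'[OF D(1,2)])
      (auto simp: sweedler_def lin_ext_def case_prod_unfold D scale_right_distrib sum.distrib
        scale_sum_right mult.commute)
qed

lemma sweedler_swap:
  assumes "vector_space s"
  shows "sweedler s \<Delta> (\<lambda>a b. sweedler s \<Delta>' (\<lambda>c d. f a b c d) y) x =
    sweedler s \<Delta>' (\<lambda>c d. sweedler s \<Delta> (\<lambda>a b. f a b c d) x) y"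
proof -
  interpret vector_space s by fact
  show ?thesis
    unfolding sweedler_def lin_ext_def case_prod_unfold scale_sum_right
    by (subst sum.swap) (simp add: mult.commute)
qed

text \<open>The coordinate functionals of a basis already separate points.\<close>

lemma (in vector_space) functionals_separate:
  assumes "\<And>c. Vector_Spaces.linear scale (*) c \<Longrightarrow> c x = c y"
  shows "x = y"
proof -
  define B where "B = extend_basis {}"
  have B: "independent B" "span B = UNIV"
    by (auto simp: B_def independent_extend_basis independent_empty)
  have "representation B x e = representation B y e" for e
    by (rule assms[OF linear_representation]) (use B in auto)
  then have "representation B x = representation B y" ..
  then show ?thesis
    by (metis B UNIV_I sum_nonzero_representation_eq)
qed

section \<open>Sweedler calculus in a coalgebra\<close>

context k_coalgebra
begin

lemma rep_tensor2:
  assumes "\<Delta> h = tensor2 scale p"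
  shows "rep (\<Delta> h) - p \<in> module.span fscale (bilinear_rels scale)"
proof -
  interpret F: vector_space "fscale :: 'k \<Rightarrow> ('h \<times> 'h \<Rightarrow>\<^sub>0 'k) \<Rightarrow> _" by (rule vector_space_fscale)
  have "p \<in> \<Delta> h" by (simp add: assms tensor2_def F.span_zero)
  then have "rep (\<Delta> h) \<in> \<Delta> h" unfolding rep_def by (rule someI)
  then show ?thesis by (simp add: assms tensor2_def)
qed

definition bilinear :: "('k \<Rightarrow> 'w \<Rightarrow> 'w::ab_group_add) \<Rightarrow> ('h \<Rightarrow> 'h \<Rightarrow> 'w) \<Rightarrow> bool" where
  "bilinear s f \<longleftrightarrow> (\<forall>b. Vector_Spaces.linear scale s (\<lambda>a. f a b)) \<and>
     (\<forall>a. Vector_Spaces.linear scale s (\<lambda>b. f a b))"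

lemma bilinearI:
  assumes "\<And>b. Vector_Spaces.linear scale s (\<lambda>a. f a b)"
    and "\<And>a. Vector_Spaces.linear scale s (\<lambda>b. f a b)"
  shows "bilinear s f"
  using assms by (simp add: bilinear_def)

lemma bilinearD:
  assumes "bilinear s f"
  shows "Vector_Spaces.linear scale s (\<lambda>a. f a b)" "Vector_Spaces.linear scale s (\<lambda>b. f a b)"
  using assms by (simp_all add: bilinear_def)

text \<open>A bilinear \<open>f\<close> kills the relations, so any representative \<open>p\<close>
  may replace the chosen one. This turns the axioms on \<Delta>, which are equalities of cosets,
  into computation rules.\<close>

lemma sweedler_eq_lin_ext:
  assumes h: "\<Delta> h = tensor2 scale p" and f: "bilinear s f"
  shows "sweedler s \<Delta> f h = lin_ext s (\<lambda>(a, b). f a b) p"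
proof -
  note D1 = linearD[OF bilinearD(1)[OF f]]
  note D2 = linearD[OF bilinearD(2)[OF f]]
  note s = D1(2)
  show ?thesis
    unfolding sweedler_def
    by (rule lin_ext_eqI[OF s rep_tensor2[OF h]])
      (auto simp: bilinear_rels_def linearD[OF linear_lin_ext[OF s]] lin_ext_basis_vec[OF s] D1 D2)
qed

lemma linear_sweedler_bilinear:
  assumes f: "bilinear s f"
  shows "Vector_Spaces.linear scale s (\<lambda>h. sweedler s \<Delta> f h)"
proof -
  note D = linearD[OF bilinearD(1)[OF f]]
  note L = linearD[OF linear_lin_ext[OF D(2)]]
  show ?thesis
    by (rule linearI'[OF D(1,2)])
      \<comment> \<open>\<open>sweedler\<close> stays folded until the representatives of \<Delta>
        at a sum and at a multiple have been replaced by those supplied by the axioms.\<close>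
      (simp_all only: sweedler_eq_lin_ext[OF comult_add f] sweedler_eq_lin_ext[OF comult_scale f] L,
        simp_all only: sweedler_def)
qed

text \<open>The linear extension of a trilinear \<open>f\<close> kills the trilinear relations,
  hence agrees on the two elements that \<open>coassoc\<close> puts in one coset.\<close>

lemma sweedler_coassoc:
  assumes 1: "\<And>b c. Vector_Spaces.linear scale s (\<lambda>a. f a b c)"
    and 2: "\<And>a c. Vector_Spaces.linear scale s (\<lambda>b. f a b c)"
    and 3: "\<And>a b. Vector_Spaces.linear scale s (\<lambda>c. f a b c)"
  shows "sweedler s \<Delta> (\<lambda>a b. sweedler s \<Delta> (\<lambda>a1 a2. f a1 a2 b) a) h =
    sweedler s \<Delta> (\<lambda>a b. sweedler s \<Delta> (\<lambda>b1 b2. f a b1 b2) b) h"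
proof -
  interpret F: vector_space "fscale :: 'k \<Rightarrow> ('h \<times> 'h \<times> 'h \<Rightarrow>\<^sub>0 'k) \<Rightarrow> _" by (rule vector_space_fscale)
  note D1 = linearD[OF 1] and D2 = linearD[OF 2] and D3 = linearD[OF 3]
  note s = D1(2)
  let ?P = "sweedler fscale \<Delta>
         (\<lambda>h1 h2. sweedler fscale \<Delta> (\<lambda>h11 h12. basis_vec (h11, h12, h2)) h1) h"
  let ?Q = "sweedler fscale \<Delta>
         (\<lambda>h1 h2. sweedler fscale \<Delta> (\<lambda>h21 h22. basis_vec (h1, h21, h22)) h2) h"
  have "?P \<in> tensor3 scale ?P" by (simp add: tensor3_def F.span_zero)
  then have "?P - ?Q \<in> module.span fscale (trilinear_rels scale)"
    unfolding coassoc by (simp add: tensor3_def)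
  then have "lin_ext s (\<lambda>(a, b, c). f a b c) ?P = lin_ext s (\<lambda>(a, b, c). f a b c) ?Q"
    by (rule lin_ext_eqI[OF s])
      (auto simp: trilinear_rels_def linearD[OF linear_lin_ext[OF s]] lin_ext_basis_vec[OF s] D1 D2 D3)
  then show ?thesis
    by (simp add: sweedler_linear[OF linear_lin_ext[OF s]] lin_ext_basis_vec[OF s])
qed

lemma sweedler_counit_left:
  assumes "Vector_Spaces.linear scale s T"
  shows "sweedler s \<Delta> (\<lambda>a b. s (\<epsilon> a) (T b)) h = T h"
  using sweedler_linear[OF assms, of \<Delta> "\<lambda>a b. scale (\<epsilon> a) b" h]
  by (simp add: counit_left linearD[OF assms])

lemma sweedler_counit_right:
  assumes "Vector_Spaces.linear scale s T"
  shows "sweedler s \<Delta> (\<lambda>a b. s (\<epsilon> b) (T a)) h = T h"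
  using sweedler_linear[OF assms, of \<Delta> "\<lambda>a b. scale (\<epsilon> b) a" h]
  by (simp add: counit_right linearD[OF assms])

lemma sweedler_grouplike:
  assumes "\<Delta> g = tensor2 scale (basis_vec (g, g))" "bilinear s f"
  shows "sweedler s \<Delta> f g = f g g"
  by (simp add: sweedler_eq_lin_ext[OF assms]
      lin_ext_basis_vec[OF linearD(2)[OF bilinearD(1)[OF assms(2)]]])

text \<open>An element \<open>\<Sum> a\<^sub>i \<otimes> b\<^sub>i\<close> with \<open>\<Sum> c(a\<^sub>i) b\<^sub>i \<in> N\<close> for all functionals \<open>c\<close> lies in
  \<open>H \<otimes> N\<close>, as one sees by expanding the \<open>a\<^sub>i\<close> in a basis.\<close>

lemma sweedler_eq_0I:
  assumes f: "bilinear s f"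
    and N: "\<And>c. Vector_Spaces.linear scale (*) c \<Longrightarrow> sweedler scale \<Delta> (\<lambda>a b. scale (c a) b) h \<in> N"
    and f0: "\<And>a b. b \<in> N \<Longrightarrow> f a b = 0"
  shows "sweedler s \<Delta> f h = 0"
proof -
  define B where "B = extend_basis {}"
  have B: "independent B" "span B = UNIV"
    by (auto simp: B_def independent_extend_basis independent_empty)
  let ?c = "\<lambda>e a. representation B a e"
  have c: "Vector_Spaces.linear scale (*) (?c e)" for e
    by (rule linear_representation) (use B in auto)
  let ?K = "Poly_Mapping.keys (rep (\<Delta> h))"
  \<comment> \<open>Finitely many basis vectors suffice to expand all first legs of the chosen
    representative.\<close>
  define E where "E = (\<Union>x\<in>?K. {e. ?c e (fst x) \<noteq> 0})"
  have E: "finite E" by (auto simp: E_def finite_representation)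
  have expand: "(\<Sum>e\<in>E. scale (?c e (fst x)) e) = fst x" if "x \<in> ?K" for x
  proof -
    have "(\<Sum>e\<in>E. scale (?c e (fst x)) e) = (\<Sum>e | ?c e (fst x) \<noteq> 0. scale (?c e (fst x)) e)"
      using that E by (intro sum.mono_neutral_right) (auto simp: E_def)
    also have "\<dots> = fst x" using B by (intro sum_nonzero_representation_eq) auto
    finally show ?thesis .
  qed
  note D1 = linearD[OF bilinearD(1)[OF f]]
  interpret W: vector_space s by (rule D1(2))
  have f1: "f (\<Sum>e\<in>E. g e) b = (\<Sum>e\<in>E. f (g e) b)" for g b
    using E by (induction rule: finite_induct) (auto simp: D1)
  have "sweedler s \<Delta> f h =
      (\<Sum>x\<in>?K. s (Poly_Mapping.lookup (rep (\<Delta> h)) x) (f (\<Sum>e\<in>E. scale (?c e (fst x)) e) (snd x)))"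
    by (auto simp: sweedler_def lin_ext_def case_prod_unfold expand intro!: sum.cong)
  also have "\<dots> = (\<Sum>x\<in>?K. \<Sum>e\<in>E.
      s (Poly_Mapping.lookup (rep (\<Delta> h)) x) (s (?c e (fst x)) (f e (snd x))))"
    by (simp only: f1 W.scale_sum_right D1)
  also have "\<dots> = (\<Sum>e\<in>E. sweedler s \<Delta> (\<lambda>a b. s (?c e a) (f e b)) h)"
    by (subst sum.swap) (simp add: sweedler_def lin_ext_def case_prod_unfold)
  \<comment> \<open>Linearity in the second slot collects, for each \<open>e\<close>, all second
    legs into a single element, which lies in \<open>N\<close>.\<close>
  also have "\<dots> = (\<Sum>e\<in>E. f e (sweedler scale \<Delta> (\<lambda>a b. scale (?c e a) b) h))"
    by (simp add: sweedler_linear[OF bilinearD(2)[OF f]] linearD[OF bilinearD(2)[OF f]])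
  also have "\<dots> = 0"
    by (intro sum.neutral ballI f0 N c)
  finally show ?thesis .
qed

end


section \<open>The antipode\<close>

context hopf_algebra
begin

section \<open>Rules for proving linearity and cancelling antipodes\<close>

lemma linear_id: "Vector_Spaces.linear scale scale (\<lambda>x. x)"
  by (rule linearI') (auto intro: vector_space_axioms)

lemma linear_mult_left:
  assumes "Vector_Spaces.linear s scale f"
  shows "Vector_Spaces.linear s scale (\<lambda>x. f x * y)"
  using linearD[OF assms] by (intro linearI') (auto simp: algebra_simps scale_mult_left)

lemma linear_mult_right:
  assumes "Vector_Spaces.linear s scale f"
  shows "Vector_Spaces.linear s scale (\<lambda>x. y * f x)"
  using linearD[OF assms] by (intro linearI') (auto simp: algebra_simps scale_mult_right)

lemma linear_scale_left:
  assumes "Vector_Spaces.linear s (*) f"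
  shows "Vector_Spaces.linear s scale (\<lambda>x. scale (f x) y)"
  using linearD[OF assms] by (intro linearI') (auto simp: scale_left_distrib vector_space_axioms)

lemma linear_scale_right:
  assumes "Vector_Spaces.linear s scale f"
  shows "Vector_Spaces.linear s scale (\<lambda>x. scale c (f x))"
  using linearD[OF assms] by (intro linearI') (auto simp: scale_right_distrib mult.commute)

lemma linear_times_left:
  assumes "Vector_Spaces.linear s (*) f"
  shows "Vector_Spaces.linear s (*) (\<lambda>x. f x * y)"
  using linearD[OF assms] by (intro linearI') (auto simp: algebra_simps)

lemma linear_times_right:
  assumes "Vector_Spaces.linear s (*) f"
  shows "Vector_Spaces.linear s (*) (\<lambda>x. y * f x)"
  using linearD[OF assms] by (intro linearI') (auto simp: algebra_simps)

lemmas linear_S = linear_comp[OF antipode_linear]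
lemmas linear_\<epsilon> = linear_comp[OF counit_linear]

lemma linear_sweedler_arg:
  assumes "\<And>b. Vector_Spaces.linear scale s (\<lambda>a. f a b)"
    and "\<And>a. Vector_Spaces.linear scale s (\<lambda>b. f a b)"
    and "Vector_Spaces.linear scale scale g"
  shows "Vector_Spaces.linear scale s (\<lambda>x. sweedler s \<Delta> f (g x))"
  by (rule linear_comp[OF linear_sweedler_bilinear[OF bilinearI] assms(3)]) (rule assms)+

text \<open>Structural rules that discharge the linearity side conditions of the Sweedler lemmas by
  following the shape of the term.\<close>

lemmas linear_rules = linear_id linear_S linear_\<epsilon> linear_mult_left linear_mult_right
  linear_scale_left linear_scale_right linear_times_left linear_times_right
  linear_sweedler linear_sweedler_arg

lemma sweedler_comult_mult:
  assumes 1: "\<And>b. Vector_Spaces.linear scale s (\<lambda>a. f a b)"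
    and 2: "\<And>a. Vector_Spaces.linear scale s (\<lambda>b. f a b)"
  shows "sweedler s \<Delta> f (x * y) =
    sweedler s \<Delta> (\<lambda>x1 x2. sweedler s \<Delta> (\<lambda>y1 y2. f (x1 * y1) (x2 * y2)) y) x"
proof -
  note s = linearD(2)[OF 1]
  have f: "bilinear s f" using 1 2 by (rule bilinearI)
  show ?thesis
    by (simp add: sweedler_eq_lin_ext[OF comult_mult f] sweedler_linear[OF linear_lin_ext[OF s]]
        lin_ext_basis_vec[OF s])
qed

text \<open>Coassociativity places \<open>S a\<close> next to its neighbouring leg, the antipode
  axiom turns that product into a counit, and the counit disappears.\<close>

lemma antipode_cancel_left:
  assumes 1: "\<And>b. Vector_Spaces.linear scale s (\<lambda>a. f a b)"
    and 2: "\<And>a. Vector_Spaces.linear scale s (\<lambda>b. f a b)"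
  shows "sweedler s \<Delta> (\<lambda>a b. sweedler s \<Delta> (\<lambda>b1 b2. f (S a * b1) b2) b) h = f 1 h"
proof -
  have "sweedler s \<Delta> (\<lambda>a b. sweedler s \<Delta> (\<lambda>b1 b2. f (S a * b1) b2) b) h =
      sweedler s \<Delta> (\<lambda>a b. sweedler s \<Delta> (\<lambda>a1 a2. f (S a1 * a2) b) a) h"
    by (rule sweedler_coassoc[symmetric]) (intro linear_comp[OF 1] 2 linear_rules)+
  also have "\<dots> = sweedler s \<Delta> (\<lambda>a b. s (\<epsilon> a) (f 1 b)) h"
    by (simp add: sweedler_linear[OF 1, symmetric] antipode_left linearD[OF 1])
  also have "\<dots> = f 1 h" by (rule sweedler_counit_left[OF 2])
  finally show ?thesis .
qed

lemma antipode_cancel_right: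
  assumes 1: "\<And>b. Vector_Spaces.linear scale s (\<lambda>a. f a b)"
    and 2: "\<And>a. Vector_Spaces.linear scale s (\<lambda>b. f a b)"
  shows "sweedler s \<Delta> (\<lambda>a b. sweedler s \<Delta> (\<lambda>a1 a2. f a1 (a2 * S b)) a) h = f h 1"
proof -
  have "sweedler s \<Delta> (\<lambda>a b. sweedler s \<Delta> (\<lambda>a1 a2. f a1 (a2 * S b)) a) h =
      sweedler s \<Delta> (\<lambda>a b. sweedler s \<Delta> (\<lambda>b1 b2. f a (b1 * S b2)) b) h"
    by (rule sweedler_coassoc) (intro linear_comp[OF 2] 1 linear_rules)+
  also have "\<dots> = sweedler s \<Delta> (\<lambda>a b. s (\<epsilon> b) (f a 1)) h"
    by (simp add: sweedler_linear[OF 2, symmetric] antipode_right linearD[OF 2])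
  also have "\<dots> = f h 1" by (rule sweedler_counit_right[OF 1])
  finally show ?thesis .
qed

section \<open>The antipode on products and grouplike elements\<close>

lemma sweedler_mult_right:
  "sweedler scale \<Delta>' f h * y = sweedler scale \<Delta>' (\<lambda>a b. f a b * y) h"
  by (rule sweedler_linear[OF linear_mult_left[OF linear_id]])

lemma sweedler_mult_left:
  "y * sweedler scale \<Delta>' f h = sweedler scale \<Delta>' (\<lambda>a b. y * f a b) h"
  by (rule sweedler_linear[OF linear_mult_right[OF linear_id]])

lemma sweedler_scale:
  "scale c (sweedler scale \<Delta>' f h) = sweedler scale \<Delta>' (\<lambda>a b. scale c (f a b)) h"
  by (rule sweedler_linear[OF linear_scale_right[OF linear_id]])

text \<open>The usual convolution argument for \<open>S(x y) = S(y) S(x)\<close>, cancelling \<open>y\<close> first and then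
  \<open>x\<close>.\<close>

lemma antipode_mult_convolve:
  "sweedler scale \<Delta> (\<lambda>x1 x2. S (x1 * y) * x2) x = scale (\<epsilon> x) (S y)"
proof -
  \<comment> \<open>The factor \<open>1\<close> is the slot that
    \<open>antipode_cancel_right\<close>, read backwards, fills with
    \<open>y12 * S y2\<close>.\<close>
  have "sweedler scale \<Delta> (\<lambda>x1 x2. S (x1 * y) * x2 * 1) x =
      sweedler scale \<Delta> (\<lambda>y1 y2. sweedler scale \<Delta> (\<lambda>y11 y12.
        sweedler scale \<Delta> (\<lambda>x1 x2. S (x1 * y11) * x2 * (y12 * S y2)) x) y1) y"
    by (rule antipode_cancel_right[symmetric]) (intro linear_rules)+
  also have "\<dots> = sweedler scale \<Delta> (\<lambda>y1 y2. sweedler scale \<Delta> (\<lambda>u v. S u * v) (x * y1) * S y2) y"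
  proof -
    \<comment> \<open>Multiplicativity of \<Delta> reassembles the inner sums into one over the legs
      of \<open>x * y1\<close>, where the antipode axiom applies.\<close>
    have "sweedler scale \<Delta> (\<lambda>u v. S u * v) (x * y1) = sweedler scale \<Delta> (\<lambda>y11 y12.
        sweedler scale \<Delta> (\<lambda>x1 x2. S (x1 * y11) * (x2 * y12)) x) y1" for y1
      by (subst sweedler_comult_mult, (intro linear_rules)+, rule sweedler_swap[OF vector_space_axioms])
    then show ?thesis by (simp add: sweedler_mult_right mult.assoc)
  qed
  also have "\<dots> = scale (\<epsilon> x) (sweedler scale \<Delta> (\<lambda>y1 y2. scale (\<epsilon> y1) (S y2)) y)"
    by (simp add: antipode_left counit_mult scale_mult_left sweedler_scale)
  also have "\<dots> = scale (\<epsilon> x) (S y)"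
    by (simp add: sweedler_counit_left[OF antipode_linear])
  finally show ?thesis by simp
qed

lemma antipode_mult: "S (x * y) = S y * S x"
proof -
  have "S (x * y) * 1 =
      sweedler scale \<Delta> (\<lambda>a b. sweedler scale \<Delta> (\<lambda>a1 a2. S (a1 * y) * (a2 * S b)) a) x"
    by (rule antipode_cancel_right[symmetric]) (intro linear_rules)+
  also have "\<dots> = sweedler scale \<Delta> (\<lambda>a b. scale (\<epsilon> a) (S y * S b)) x"
    by (simp add: mult.assoc[symmetric] sweedler_mult_right[symmetric] antipode_mult_convolve
        scale_mult_left)
  also have "\<dots> = S y * S x"
    by (rule sweedler_counit_left) (intro linear_rules)
  finally show ?thesis by simp
qed

lemma antipode_one: "S 1 = 1"
proof -
  have "sweedler scale \<Delta> (\<lambda>a b. S a * b) 1 = S 1 * 1"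
    by (rule sweedler_grouplike[OF comult_one bilinearI]) (intro linear_rules)+
  then show ?thesis by (simp add: antipode_left counit_one)
qed

lemma antipode_grouplike:
  assumes "grouplike scale \<Delta> \<epsilon> g"
  shows "S g * g = 1" "g * S g = 1"
proof -
  have g: "\<Delta> g = tensor2 scale (basis_vec (g, g))" "\<epsilon> g = 1"
    using assms by (auto simp: grouplike_def)
  have "sweedler scale \<Delta> (\<lambda>a b. S a * b) g = S g * g"
    by (rule sweedler_grouplike[OF g(1) bilinearI]) (intro linear_rules)+
  then show "S g * g = 1" by (simp add: antipode_left g)
  have "sweedler scale \<Delta> (\<lambda>a b. a * S b) g = g * S g"
    by (rule sweedler_grouplike[OF g(1) bilinearI]) (intro linear_rules)+
  then show "g * S g = 1" by (simp add: antipode_right g)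
qed

lemma mult_inverse_eqI:
  assumes "x * y = 1" "y * x = 1"
  shows "mult_inverse x = (y :: 'h)"
  unfolding mult_inverse_def
proof (rule the_equality)
  fix z assume "x * z = 1 \<and> z * x = 1"
  then show "z = y" using assms by (metis mult.assoc mult_1_left mult_1_right)
qed (simp add: assms)

lemma mult_inverse_grouplike:
  assumes "grouplike scale \<Delta> \<epsilon> g"
  shows "mult_inverse g = S g"
  using antipode_grouplike[OF assms] by (intro mult_inverse_eqI) auto

text \<open>Both sides are inverse to \<open>S g\<close>, because \<open>S\<close> reverses products
  and fixes \<open>1\<close>.\<close>

lemma antipode_antipode_grouplike:
  assumes "grouplike scale \<Delta> \<epsilon> g"
  shows "S (S g) = g"
proof -
  have "S g * S (S g) = 1"
    using antipode_grouplike[OF assms] by (metis antipode_mult antipode_one)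
  then show ?thesis
    using antipode_grouplike[OF assms] by (metis mult.assoc mult_1_left mult_1_right)
qed

end


section \<open>Integrals and the Nakayama automorphism\<close>

text \<open>Fixes one pair \<open>l\<close>, \<chi> witnessing that \<alpha> is
  distinguished.\<close>

locale nakayama_hopf_algebra = hopf_algebra scale \<Delta> \<epsilon> S
  for scale :: "'k::field \<Rightarrow> 'h::ring_1 \<Rightarrow> 'h" and \<Delta> \<epsilon> S +
  fixes l :: "'h \<Rightarrow> 'k" and \<chi> :: "'h \<Rightarrow> 'h" and \<alpha> :: "'h \<Rightarrow> 'k"
  assumes left_integral: "l \<in> left_integrals scale \<Delta>"
    and nonzero: "l \<noteq> (\<lambda>_. 0)"
    and nakayama: "nakayama_automorphism scale l \<chi>"
    and \<alpha>_def: "\<alpha> = \<epsilon> \<circ> \<chi>"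
begin

lemma l_linear: "Vector_Spaces.linear scale (*) l"
  and integral: "sweedler scale \<Delta> (\<lambda>h1 h2. scale (l h2) h1) h = scale (l h) 1"
  using left_integral by (auto simp: left_integrals_def dual_def)

lemma \<chi>_linear: "Vector_Spaces.linear scale scale \<chi>"
  and \<chi>_one: "\<chi> 1 = 1"
  and \<chi>_mult: "\<chi> (x * y) = \<chi> x * \<chi> y"
  and \<chi>_bij: "bij \<chi>"
  and integral_swap: "l (x * y) = l (\<chi> y * x)"
  using nakayama
  by (auto simp: nakayama_automorphism_def algebra_automorphism_def act_left_def act_right_def
      fun_eq_iff)

lemma \<alpha>_linear: "Vector_Spaces.linear scale (*) \<alpha>"
  unfolding \<alpha>_def comp_def by (rule linear_comp[OF counit_linear \<chi>_linear])

lemmas linear_l = linear_comp[OF l_linear]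
lemmas linear_\<chi> = linear_comp[OF \<chi>_linear]
lemmas linear_\<alpha> = linear_comp[OF \<alpha>_linear]

lemmas linear_intros = linear_rules linear_l linear_\<chi> linear_\<alpha>

text \<open>Invariance at \<open>h2 * m\<close> rewrites S(h1) l(h2 m) as S(h1) h2 m1 l(h3 m2), and
  S(h1) h2 cancels.\<close>

lemma integral_left_shift:
  "sweedler scale \<Delta> (\<lambda>h1 h2. scale (l (h2 * m)) (S h1)) h =
    sweedler scale \<Delta> (\<lambda>m1 m2. scale (l (h * m2)) m1) m"
proof -
  have eq: "scale (l (b * m)) (S a) = sweedler scale \<Delta> (\<lambda>b1 b2.
      sweedler scale \<Delta> (\<lambda>m1 m2. scale (l (b2 * m2)) (S a * b1 * m1)) m) b" for a b
  proof -
    have "sweedler scale \<Delta> (\<lambda>b1 b2.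
        sweedler scale \<Delta> (\<lambda>m1 m2. scale (l (b2 * m2)) (S a * b1 * m1)) m) b =
        sweedler scale \<Delta> (\<lambda>u v. scale (l v) (S a * u)) (b * m)"
      by (subst sweedler_comult_mult, (intro linear_intros)+, simp add: mult.assoc)
    also have "\<dots> = S a * sweedler scale \<Delta> (\<lambda>u v. scale (l v) u) (b * m)"
      by (simp add: sweedler_mult_left scale_mult_right)
    also have "\<dots> = scale (l (b * m)) (S a)"
      by (simp add: integral scale_mult_right)
    finally show ?thesis by simp
  qed
  have "sweedler scale \<Delta> (\<lambda>a b. scale (l (b * m)) (S a)) h =
     sweedler scale \<Delta> (\<lambda>m1 m2. scale (l (h * m2)) (1 * m1)) m"
    unfolding eq by (rule antipode_cancel_left) (intro linear_intros)+
  then show ?thesis by simp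
qed

lemma integral_nondegenerate:
  assumes "\<And>h. l (h * m) = 0"
  shows "m = 0"
proof -
  \<comment> \<open>By the left shift \<open>N\<close> is a left ideal with \<open>\<Delta>(N) \<subseteq> H \<otimes> N\<close>, so
    \<open>\<epsilon>(m) 1 = S(m\<^sub>1) m\<^sub>2 \<in> N\<close>.  This side of the radical avoids bijectivity of \<open>S\<close>.\<close>
  define N where "N = {m. \<forall>h. l (h * m) = 0}"
  have comult_N: "sweedler scale \<Delta> (\<lambda>a b. scale (c a) b) m \<in> N"
    if m: "m \<in> N" and c: "Vector_Spaces.linear scale (*) c" for m c
  proof -
    have "l (h * sweedler scale \<Delta> (\<lambda>a b. scale (c a) b) m) = 0" for h
    proof -
      \<comment> \<open>With \<open>c\<close> moved outside, the remaining sum is one side of the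
        left shift; on the other side every coefficient \<open>l (b * m)\<close> vanishes.\<close>
      have "l (h * sweedler scale \<Delta> (\<lambda>a b. scale (c a) b) m) =
          sweedler (*) \<Delta> (\<lambda>a b. l (h * scale (c a) b)) m"
        by (rule sweedler_linear) (intro linear_intros)
      also have "\<dots> = sweedler (*) \<Delta> (\<lambda>a b. c (scale (l (h * b)) a)) m"
        by (simp add: scale_mult_right linearD[OF c] linearD[OF l_linear] mult.commute)
      also have "\<dots> = c (sweedler scale \<Delta> (\<lambda>a b. scale (l (h * b)) a) m)"
        by (rule sweedler_linear[OF c, symmetric])
      also have "sweedler scale \<Delta> (\<lambda>a b. scale (l (h * b)) a) m =
          sweedler scale \<Delta> (\<lambda>a b. scale (l (b * m)) (S a)) h"
        by (rule integral_left_shift[symmetric])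
      also have "\<dots> = 0"
        using m by (simp add: N_def sweedler_def lin_ext_def case_prod_unfold)
      finally show ?thesis by (simp add: linearD[OF c])
    qed
    then show ?thesis by (simp add: N_def)
  qed
  have \<epsilon>_N: "\<epsilon> m = 0" if m: "m \<in> N" for m
  proof -
    \<comment> \<open>Testing S(m1) m2 against this \<open>h\<close> gives \<epsilon>(m) l(h) =
      0.\<close>
    obtain h where h: "l h \<noteq> 0" using nonzero by auto
    have "sweedler (*) \<Delta> (\<lambda>a b. l (h * (S a * b))) m = 0"
    proof (rule sweedler_eq_0I[OF bilinearI])
      show "sweedler scale \<Delta> (\<lambda>a b. scale (c a) b) m \<in> N"
        if "Vector_Spaces.linear scale (*) c" for c
        using m that by (rule comult_N)
      show "l (h * (S a * b)) = 0" if "b \<in> N" for a b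
        using that by (simp add: N_def mult.assoc[symmetric])
    qed (intro linear_intros)+
    moreover have "sweedler (*) \<Delta> (\<lambda>a b. l (h * (S a * b))) m =
        l (h * sweedler scale \<Delta> (\<lambda>a b. S a * b) m)"
      by (rule sweedler_linear[symmetric]) (intro linear_intros)
    ultimately show ?thesis
      using h by (simp add: antipode_left scale_mult_right linearD[OF l_linear])
  qed
  have "m \<in> N" using assms by (simp add: N_def)
  \<comment> \<open>The second legs of \<Delta> m may be taken in \<open>N\<close>, where \<epsilon>
    vanishes, while the counit axiom identifies this sum with \<open>m\<close>.\<close>
  have "sweedler scale \<Delta> (\<lambda>a b. scale (\<epsilon> b) a) m = 0"
  proof (rule sweedler_eq_0I[OF bilinearI])
    show "sweedler scale \<Delta> (\<lambda>a b. scale (c a) b) m \<in> N"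
      if "Vector_Spaces.linear scale (*) c" for c
      using \<open>m \<in> N\<close> that by (rule comult_N)
    show "scale (\<epsilon> b) a = 0" if "b \<in> N" for a b
      using that by (simp add: \<epsilon>_N)
  qed (intro linear_intros)+
  then show ?thesis by (simp add: counit_right)
qed

text \<open>Nondegeneracy in the other argument: surjectivity of \<chi> and the Nakayama rule carry
  it across.\<close>

lemma integral_cancel:
  assumes "\<And>h. l (x * h) = l (y * h)"
  shows "x = y"
proof -
  obtain m where m: "\<chi> m = x - y" using \<chi>_bij by (metis bij_pointE)
  have "l (h * m) = 0" for h
    by (simp add: integral_swap[of h] m left_diff_distrib linearD[OF l_linear] assms)
  then have "m = 0" by (rule integral_nondegenerate)
  then show ?thesis using m by (simp add: linearD[OF \<chi>_linear])
qed

text \<open>Cancelling the integral in one leg of \<open>H \<otimes> H\<close> and applying \<open>\<epsilon>\<close> to that leg.\<close>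

lemma integral_cancel_leg:
  assumes eq: "\<And>h. sweedler scale \<Delta> (\<lambda>a b. scale (l (p a b * h)) (u a b)) x =
      sweedler scale \<Delta> (\<lambda>a b. scale (l (q a b * h)) (v a b)) y"
  shows "sweedler scale \<Delta> (\<lambda>a b. scale (\<epsilon> (p a b)) (u a b)) x =
    sweedler scale \<Delta> (\<lambda>a b. scale (\<epsilon> (q a b)) (v a b)) y"
proof -
  have expand: "c (sweedler scale \<Delta> (\<lambda>a b. scale (e (p a b)) (u a b)) x) =
      e (sweedler scale \<Delta> (\<lambda>a b. scale (c (u a b)) (p a b)) x)"
    if c: "Vector_Spaces.linear scale (*) c" and e: "Vector_Spaces.linear scale (*) e"
    for c e p u x
    by (simp add: sweedler_linear[OF c] sweedler_linear[OF e] linearD[OF c] linearD[OF e]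
        mult.commute)
  have "c (sweedler scale \<Delta> (\<lambda>a b. scale (\<epsilon> (p a b)) (u a b)) x) =
      c (sweedler scale \<Delta> (\<lambda>a b. scale (\<epsilon> (q a b)) (v a b)) y)"
    if c: "Vector_Spaces.linear scale (*) c" for c
  proof -
    \<comment> \<open>Applying \<open>c\<close> to the other leg leaves an equation in
      \<open>H\<close> alone, from which the integral can be cancelled.\<close>
    have "sweedler scale \<Delta> (\<lambda>a b. scale (c (u a b)) (p a b)) x =
        sweedler scale \<Delta> (\<lambda>a b. scale (c (v a b)) (q a b)) y"
    proof (rule integral_cancel)
      fix h
      have "Vector_Spaces.linear scale (*) (\<lambda>z. l (z * h))" by (intro linear_intros)
      from expand[OF c this, of p u x] expand[OF c this, of q v y]
      show "l (sweedler scale \<Delta> (\<lambda>a b. scale (c (u a b)) (p a b)) x * h) =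
          l (sweedler scale \<Delta> (\<lambda>a b. scale (c (v a b)) (q a b)) y * h)"
        by (simp add: eq)
    qed
    then show ?thesis by (simp add: expand[OF c counit_linear])
  qed
  then show ?thesis by (rule functionals_separate)
qed

text \<open>The left shift is used first with the pair \<open>h\<close>, \<open>m\<close> and then
  with \<chi>(m), \<open>h\<close>; each use contributes one \<open>S\<close>.\<close>

lemma dual_act_left_\<alpha>: "dual_act_left scale \<Delta> \<alpha> m = S (S (\<chi> m))"
proof -
  have "sweedler scale \<Delta> (\<lambda>a b. scale (\<epsilon> (\<chi> b)) a) m =
      sweedler scale \<Delta> (\<lambda>a b. scale (\<epsilon> b) (S (S a))) (\<chi> m)"
  proof (rule integral_cancel_leg)
    fix h
    have "sweedler scale \<Delta> (\<lambda>a b. scale (l (\<chi> b * h)) a) m =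
        sweedler scale \<Delta> (\<lambda>a b. scale (l (h * b)) a) m"
      by (simp add: integral_swap[of h])
    also have "\<dots> = sweedler scale \<Delta> (\<lambda>h1 h2. scale (l (h2 * m)) (S h1)) h"
      by (rule integral_left_shift[symmetric])
    also have "\<dots> = S (sweedler scale \<Delta> (\<lambda>h1 h2. scale (l (\<chi> m * h2)) h1) h)"
      by (simp add: integral_swap[of _ m] sweedler_linear[OF antipode_linear]
          linearD[OF antipode_linear])
    also have "\<dots> = S (sweedler scale \<Delta> (\<lambda>a b. scale (l (b * h)) (S a)) (\<chi> m))"
      by (simp add: integral_left_shift)
    also have "\<dots> = sweedler scale \<Delta> (\<lambda>a b. scale (l (b * h)) (S (S a))) (\<chi> m)"
      by (simp add: sweedler_linear[OF antipode_linear] linearD[OF antipode_linear])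
    finally show "sweedler scale \<Delta> (\<lambda>a b. scale (l (\<chi> b * h)) a) m = \<dots>" .
  qed
  also have "\<dots> = S (S (\<chi> m))"
    by (rule sweedler_counit_right) (intro linear_intros)
  finally show ?thesis by (simp add: dual_act_left_def \<alpha>_def)
qed

text \<open>Inserting m2 S(m3) turns l(h1 m) h2 into l(h1 m1) h2 m2 S(m3); the defining property of
  \<open>g\<close> at \<open>h * m1\<close> then yields the inverse of \<open>g\<close>, which is
  \<open>S g\<close>.\<close>

lemma integral_right_shift:
  assumes g: "distinguished_grouplike scale \<Delta> \<epsilon> g"
  shows "sweedler scale \<Delta> (\<lambda>h1 h2. scale (l (h1 * m)) h2) h =
    sweedler scale \<Delta> (\<lambda>m1 m2. scale (l (h * m1)) (S g * S m2)) m"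
proof -
  have integral': "sweedler scale \<Delta> (\<lambda>u v. scale (l u) v) x = scale (l x) (S g)" for x
    using g left_integral mult_inverse_grouplike[of g] by (simp add: distinguished_grouplike_def)
  have "sweedler scale \<Delta> (\<lambda>h1 h2. scale (l (h1 * m)) (h2 * 1)) h =
      sweedler scale \<Delta> (\<lambda>m1 m2. sweedler scale \<Delta> (\<lambda>m11 m12.
        sweedler scale \<Delta> (\<lambda>h1 h2. scale (l (h1 * m11)) (h2 * (m12 * S m2))) h) m1) m"
    by (rule antipode_cancel_right[symmetric]) (intro linear_intros)+
  also have "\<dots> = sweedler scale \<Delta> (\<lambda>m1 m2.
      sweedler scale \<Delta> (\<lambda>u v. scale (l u) v) (h * m1) * S m2) m"
  proof -
    have "sweedler scale \<Delta> (\<lambda>u v. scale (l u) v) (h * m1) = sweedler scale \<Delta> (\<lambda>m11 m12.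
        sweedler scale \<Delta> (\<lambda>h1 h2. scale (l (h1 * m11)) (h2 * m12)) h) m1" for m1
      by (subst sweedler_comult_mult, (intro linear_intros)+, rule sweedler_swap[OF vector_space_axioms])
    then show ?thesis by (simp add: sweedler_mult_right mult.assoc scale_mult_left)
  qed
  finally show ?thesis by (simp add: integral' scale_mult_left)
qed

text \<open>The right shift is used twice, as the left shift was for the other action. Applying
  \<open>S\<close> to \<open>S g * S b\<close> reverses the factors and gives
  \<open>S (S b) * g\<close>.\<close>

lemma dual_act_right_\<alpha>:
  assumes g: "distinguished_grouplike scale \<Delta> \<epsilon> g"
  shows "S (S (dual_act_right scale \<Delta> m \<alpha>)) * g = g * \<chi> m"
proof -
  have G: "grouplike scale \<Delta> \<epsilon> g" using g by (simp add: distinguished_grouplike_def)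
  have "sweedler scale \<Delta> (\<lambda>a b. scale (\<epsilon> (\<chi> a)) (S (S b) * g)) m =
      sweedler scale \<Delta> (\<lambda>a b. scale (\<epsilon> a) (g * b)) (\<chi> m)"
  proof (rule integral_cancel_leg)
    fix h
    have "sweedler scale \<Delta> (\<lambda>a b. scale (l (\<chi> a * h)) (S (S b) * g)) m =
        S (sweedler scale \<Delta> (\<lambda>a b. scale (l (h * a)) (S g * S b)) m)"
      by (simp add: integral_swap[of h] sweedler_linear[OF antipode_linear]
          linearD[OF antipode_linear] antipode_mult antipode_antipode_grouplike[OF G])
    also have "\<dots> = S (sweedler scale \<Delta> (\<lambda>h1 h2. scale (l (h1 * m)) h2) h)"
      by (simp add: integral_right_shift[OF g])
    also have "\<dots> = sweedler scale \<Delta> (\<lambda>h1 h2. scale (l (\<chi> m * h1)) (S h2)) h"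
      by (simp add: integral_swap[of _ m] sweedler_linear[OF antipode_linear]
          linearD[OF antipode_linear])
    \<comment> \<open>Inserting \<open>g * S g = 1\<close> creates the factor \<open>S g\<close>
      required by the right shift.\<close>
    also have "\<dots> = g * sweedler scale \<Delta> (\<lambda>h1 h2. scale (l (\<chi> m * h1)) (S g * S h2)) h"
      by (simp add: sweedler_mult_left scale_mult_right mult.assoc[symmetric]
          antipode_grouplike[OF G])
    also have "\<dots> = sweedler scale \<Delta> (\<lambda>a b. scale (l (a * h)) (g * b)) (\<chi> m)"
      by (simp add: integral_right_shift[OF g, symmetric] sweedler_mult_left scale_mult_right)
    finally show "sweedler scale \<Delta> (\<lambda>a b. scale (l (\<chi> a * h)) (S (S b) * g)) m = \<dots>" .
  qed
  also have "\<dots> = g * \<chi> m"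
    by (rule sweedler_counit_left) (intro linear_intros)
  finally show ?thesis
    by (simp add: dual_act_right_def \<alpha>_def sweedler_linear[OF antipode_linear]
        linearD[OF antipode_linear] sweedler_mult_right scale_mult_left)
qed

text \<open>The square of \<open>S\<close> is multiplicative and fixes \<open>g\<close>; applied to
  \<open>dual_act_right_\<alpha>\<close> it produces \<open>g * S (S (\<chi> m))\<close>, which
  \<open>dual_act_left_\<alpha>\<close> evaluates.\<close>

lemma antipode_power4_dual_act_right:
  assumes g: "distinguished_grouplike scale \<Delta> \<epsilon> g"
  shows "(S ^^ 4) (dual_act_right scale \<Delta> m \<alpha>) = g * dual_act_left scale \<Delta> \<alpha> m * S g"
proof -
  have G: "grouplike scale \<Delta> \<epsilon> g" using g by (simp add: distinguished_grouplike_def)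
  have "S (S (S (S (dual_act_right scale \<Delta> m \<alpha>)))) * g =
      S (S (S (S (dual_act_right scale \<Delta> m \<alpha>)) * g))"
    by (simp add: antipode_mult antipode_antipode_grouplike[OF G])
  also have "\<dots> = g * dual_act_left scale \<Delta> \<alpha> m"
    by (simp add: dual_act_right_\<alpha>[OF g] antipode_mult antipode_antipode_grouplike[OF G]
        dual_act_left_\<alpha>)
  finally have "S (S (S (S (dual_act_right scale \<Delta> m \<alpha>)))) * g * S g =
      g * dual_act_left scale \<Delta> \<alpha> m * S g" by simp
  then show ?thesis
    by (simp add: mult.assoc antipode_grouplike[OF G] eval_nat_numeral)
qed

section \<open>The convolution inverse of \<alpha> and the interplay of the two actions\<close>

lemma \<alpha>_mult: "\<alpha> (x * y) = \<alpha> x * \<alpha> y" and \<alpha>_one: "\<alpha> 1 = 1"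
  by (simp_all add: \<alpha>_def \<chi>_mult \<chi>_one counit_mult counit_one)

lemma conv_inverse_\<alpha>: "conv_inverse scale \<Delta> \<epsilon> \<alpha> = (\<lambda>h. \<alpha> (S h))"
  unfolding conv_inverse_def
proof (rule the_equality)
  let ?n = "\<lambda>h. \<alpha> (S h)"
  have left: "convolution \<Delta> \<alpha> ?n = \<epsilon>" and right: "convolution \<Delta> ?n \<alpha> = \<epsilon>"
    by (simp_all add: fun_eq_iff convolution_def \<alpha>_mult[symmetric]
        sweedler_linear[OF \<alpha>_linear, symmetric] antipode_left antipode_right
        linearD[OF \<alpha>_linear] \<alpha>_one)
  have n: "Vector_Spaces.linear scale (*) ?n" by (intro linear_intros)
  show "?n \<in> dual scale \<and> convolution \<Delta> \<alpha> ?n = \<epsilon> \<and> convolution \<Delta> ?n \<alpha> = \<epsilon>"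
    using left right n by (simp add: dual_def)
  fix m assume "m \<in> dual scale \<and> convolution \<Delta> \<alpha> m = \<epsilon> \<and> convolution \<Delta> m \<alpha> = \<epsilon>"
  then have m: "Vector_Spaces.linear scale (*) m" and m\<alpha>: "convolution \<Delta> m \<alpha> = \<epsilon>"
    by (simp_all add: dual_def)
  note linear_m = linear_comp[OF m]
  show "m = ?n"
  proof
    fix h
    \<comment> \<open>Uniqueness of inverses in the convolution monoid: regroup the product of
      \<open>m\<close>, \<alpha> and \<open>?n\<close>, cancelling \<alpha> on either side.\<close>
    have "m h = sweedler (*) \<Delta> (\<lambda>a b. convolution \<Delta> \<alpha> ?n b * m a) h"
      by (simp add: left sweedler_counit_right[OF m])
    also have "\<dots> = sweedler (*) \<Delta> (\<lambda>a b. sweedler (*) \<Delta> (\<lambda>b1 b2. m a * \<alpha> b1 * ?n b2) b) h"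
      by (simp add: convolution_def sweedler_def lin_ext_def case_prod_unfold sum_distrib_left
          mult_ac)
    also have "\<dots> = sweedler (*) \<Delta> (\<lambda>a b. sweedler (*) \<Delta> (\<lambda>a1 a2. m a1 * \<alpha> a2 * ?n b) a) h"
      by (rule sweedler_coassoc[symmetric]) (intro linear_intros linear_m)+
    also have "\<dots> = sweedler (*) \<Delta> (\<lambda>a b. convolution \<Delta> m \<alpha> a * ?n b) h"
      by (simp add: convolution_def sweedler_def lin_ext_def case_prod_unfold sum_distrib_left
          mult_ac)
    also have "\<dots> = ?n h"
      by (simp add: m\<alpha> sweedler_counit_left[OF n])
    finally show "m h = ?n h" .
  qed
qed

text \<open>Multiplicativity of \<alpha> merges the two coefficients into \<alpha>(S(h1) h2), which
  antipode cancellation removes.\<close>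

lemma dual_act_right_inverse:
  "dual_act_right scale \<Delta> (dual_act_right scale \<Delta> h (\<lambda>x. \<alpha> (S x))) \<alpha> = h"
proof -
  have lin: "Vector_Spaces.linear scale scale (\<lambda>h. dual_act_right scale \<Delta> h \<alpha>)"
    unfolding dual_act_right_def by (intro linear_intros)
  have "dual_act_right scale \<Delta> (dual_act_right scale \<Delta> h (\<lambda>x. \<alpha> (S x))) \<alpha> =
      sweedler scale \<Delta> (\<lambda>a b. scale (\<alpha> (S a)) (dual_act_right scale \<Delta> b \<alpha>)) h"
    unfolding dual_act_right_def[of _ _ h] by (simp add: sweedler_linear[OF lin] linearD[OF lin])
  also have "\<dots> = sweedler scale \<Delta> (\<lambda>a b.
      sweedler scale \<Delta> (\<lambda>b1 b2. scale (\<alpha> (S a * b1)) b2) b) h"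
    by (simp add: dual_act_right_def sweedler_scale \<alpha>_mult)
  also have "\<dots> = scale (\<alpha> 1) h"
    by (rule antipode_cancel_left) (intro linear_intros)+
  finally show ?thesis by (simp add: \<alpha>_one)
qed

text \<open>Both sides are n(h1) m(h3) h2, by coassociativity.\<close>

lemma dual_act_commute:
  assumes "Vector_Spaces.linear scale (*) m" "Vector_Spaces.linear scale (*) n"
  shows "dual_act_left scale \<Delta> m (dual_act_right scale \<Delta> h n) =
    dual_act_right scale \<Delta> (dual_act_left scale \<Delta> m h) n"
proof -
  note linear_mn = linear_comp[OF assms(1)] linear_comp[OF assms(2)]
  have L: "Vector_Spaces.linear scale scale (\<lambda>h. dual_act_left scale \<Delta> m h)"
    unfolding dual_act_left_def by (intro linear_intros linear_mn)
  have R: "Vector_Spaces.linear scale scale (\<lambda>h. dual_act_right scale \<Delta> h n)"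
    unfolding dual_act_right_def by (intro linear_intros linear_mn)
  have "dual_act_left scale \<Delta> m (dual_act_right scale \<Delta> h n) = sweedler scale \<Delta> (\<lambda>a b.
      sweedler scale \<Delta> (\<lambda>b1 b2. scale (n a) (scale (m b2) b1)) b) h"
    unfolding dual_act_right_def
    by (simp add: sweedler_linear[OF L] linearD[OF L]) (simp add: dual_act_left_def sweedler_scale)
  also have "\<dots> = sweedler scale \<Delta> (\<lambda>a b.
      sweedler scale \<Delta> (\<lambda>a1 a2. scale (n a1) (scale (m b) a2)) a) h"
    by (rule sweedler_coassoc[symmetric]) (intro linear_intros linear_mn)+
  also have "\<dots> = dual_act_right scale \<Delta> (dual_act_left scale \<Delta> m h) n"
    unfolding dual_act_left_def
    by (simp add: sweedler_linear[OF R] linearD[OF R])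
      (simp add: dual_act_right_def sweedler_scale mult.commute)
  finally show ?thesis .
qed

end

theorem theorem2p8:
  fixes scale :: "'k::field \<Rightarrow> 'h::ring_1 \<Rightarrow> 'h"
    and \<Delta> :: "'h \<Rightarrow> ('h \<times> 'h \<Rightarrow>\<^sub>0 'k) set"
    and \<epsilon> \<alpha> :: "'h \<Rightarrow> 'k"
    and S :: "'h \<Rightarrow> 'h"
    and g h :: 'h
  assumes "hopf_algebra scale \<Delta> \<epsilon> S"
    and "co_frobenius scale \<Delta>"
    and "distinguished_dual_grouplike scale \<Delta> \<epsilon> \<alpha>"
    and "distinguished_grouplike scale \<Delta> \<epsilon> g"
  shows "(S ^^ 4) h =
    g * dual_act_right scale \<Delta> (dual_act_left scale \<Delta> \<alpha> h) (conv_inverse scale \<Delta> \<epsilon> \<alpha>)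
      * mult_inverse g"
proof -
  interpret hopf_algebra scale \<Delta> \<epsilon> S by fact
  obtain l \<chi> where "l \<in> left_integrals scale \<Delta>" "l \<noteq> (\<lambda>_. 0)"
      "nakayama_automorphism scale l \<chi>" "\<alpha> = \<epsilon> \<circ> \<chi>"
    using assms(3) by (auto simp: distinguished_dual_grouplike_def)
  then interpret nakayama_hopf_algebra scale \<Delta> \<epsilon> S l \<chi> \<alpha>
    by unfold_locales
  have "Vector_Spaces.linear scale (*) (\<lambda>x. \<alpha> (S x))" by (intro linear_intros)
  \<comment> \<open>Substituting the right translate of \<open>h\<close> by the inverse of \<alpha>
    makes the argument of the fourth power of \<open>S\<close> collapse to \<open>h\<close>;
    commuting the actions gives the stated order.\<close>
  then show ?thesis
    using antipode_power4_dual_act_right[OF assms(4), of "dual_act_right scale \<Delta> h (\<lambda>x. \<alpha> (S x))"]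
      mult_inverse_grouplike[of g] assms(4)
    by (simp add: dual_act_right_inverse dual_act_commute[OF \<alpha>_linear] conv_inverse_\<alpha>
        distinguished_grouplike_def)
qed

end
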